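(* Let $\varepsilon>0$ and let $L_\varepsilon$ be the simplified avalanche length of the simple symmetric random walk. Then for all complex $z$ with $|z|\le 1$, $$E[z^{L_{\varepsilon}}]=\frac{P[R_{1}>\varepsilon]}{E[1-z^{R_{1}};R_{1}\leq\varepsilon]+P[R_{1}>\varepsilon]}.$$
   Context: $(S_n)_{n\ge0}$ is a simple symmetric random walk on $\mathbb{Z}$ with $S_0=0$; write $S(k)=S_k$. Define $\rho_0=0$, $\rho_i=\inf\{n>\rho_{i-1}:S_n>S(\rho_{i-1})\}$ and $R_i=\rho_i-\rho_{i-1}$ for $i\ge1$ (simplified trading times and simplified intertrading times). The simplified avalanche length $L_\varepsilon$ is defined by: if $k\geq 0$ and $R_1\le\varepsilon,\ldots,R_k\le\varepsilon$, $R_{k+1}>\varepsilon$, then $L_\varepsilon=R_1+\cdots+R_k$ (so $L_\varepsilon=0$ if $R_1>\varepsilon$). Notation: $E[X;A]=E[X\,I_A]$. *)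

theory Defs
  imports "HOL-Probability.Probability"
begin

locale simple_symmetric_random_walk = prob_space M for M :: "'a measure" +
  fixes S :: "nat \<Rightarrow> 'a \<Rightarrow> int"
  assumes start: "\<omega> \<in> space M \<Longrightarrow> S 0 \<omega> = 0"
    and indep_increments:
      "indep_vars (\<lambda>_. count_space UNIV) (\<lambda>n \<omega>. S (Suc n) \<omega> - S n \<omega>) UNIV"
    and distr_increments:
      "distr M (count_space UNIV) (\<lambda>\<omega>. S (Suc n) \<omega> - S n \<omega>) = measure_pmf (pmf_of_set {-1, 1})"

text \<open>The following notions are defined for a single path \<open>s\<close>. Trading times are extended naturals:
  the infimum over the empty set is \<open>\<infinity>\<close>, and all later trading times are then \<open>\<infinity>\<close> as well.\<close>

primrec trading_time :: "(nat \<Rightarrow> int) \<Rightarrow> nat \<Rightarrow> enat" where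
  "trading_time s 0 = 0"
| "trading_time s (Suc i) =
    (case trading_time s i of
       enat m \<Rightarrow> (INF n\<in>{n. m < n \<and> s m < s n}. enat n)
     | \<infinity> \<Rightarrow> \<infinity>)"

text \<open>Only the indices \<open>i \<ge> 1\<close> are meaningful. Subtraction on \<^typ>\<open>enat\<close> satisfies
  \<open>\<infinity> - x = \<infinity>\<close> for all \<open>x\<close>, so an infinite trading time gives an infinite intertrading time.\<close>

definition intertrading_time :: "(nat \<Rightarrow> int) \<Rightarrow> nat \<Rightarrow> enat" where
  "intertrading_time s i = trading_time s i - trading_time s (i - 1)"

text \<open>If no intertrading time exceeds \<open>\<epsilon>\<close>, which has probability zero for the random walk, the value
  is unspecified. Otherwise all summands are finite, so \<^const>\<open>the_enat\<close> is harmless.\<close>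

definition avalanche_length :: "real \<Rightarrow> (nat \<Rightarrow> int) \<Rightarrow> nat" where
  "avalanche_length \<epsilon> s =
    (let k = (LEAST k. ereal_of_enat (intertrading_time s (k + 1)) > ereal \<epsilon>)
     in \<Sum>i=1..k. the_enat (intertrading_time s i))"

lemma avalanche_length_eq:
  assumes "\<And>i. i \<in> {1..k} \<Longrightarrow> ereal_of_enat (intertrading_time s i) \<le> ereal \<epsilon>"
    and "ereal_of_enat (intertrading_time s (k + 1)) > ereal \<epsilon>"
  shows "enat (avalanche_length \<epsilon> s) = (\<Sum>i=1..k. intertrading_time s i)"
proof -
  have "(LEAST k. ereal_of_enat (intertrading_time s (k + 1)) > ereal \<epsilon>) = k"
  proof (rule Least_equality)
    fix j assume j: "ereal_of_enat (intertrading_time s (j + 1)) > ereal \<epsilon>"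
    show "k \<le> j"
    proof (rule ccontr)
      assume "\<not> k \<le> j"
      then show False using assms(1)[of "j + 1"] j by auto
    qed
  qed (rule assms(2))
  then have "enat (avalanche_length \<epsilon> s) = enat (\<Sum>i=1..k. the_enat (intertrading_time s i))"
    by (simp add: avalanche_length_def)
  also have "\<dots> = (\<Sum>i=1..k. enat (the_enat (intertrading_time s i)))"
    by (simp flip: of_nat_eq_enat)
  also have "\<dots> = (\<Sum>i=1..k. intertrading_time s i)"
  proof (rule sum.cong)
    fix i assume "i \<in> {1..k}"
    then show "enat (the_enat (intertrading_time s i)) = intertrading_time s i"
      using assms(1)[of i] by (cases "intertrading_time s i") auto
  qed simp
  finally show ?thesis .
qed

end

theory Submission
  imports Defs
begin

text \<open>A renewal argument at the first trading time. On \<open>{R\<^sub>1 = r}\<close>, an event determined by the first \<open>r\<close>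
  increments, with \<open>r \<le> \<epsilon>\<close>, the avalanche length is \<open>r\<close> plus the avalanche length of the walk
  restarted at time \<open>r\<close>, which is independent of \<open>{R\<^sub>1 = r}\<close> and distributed as the original walk.
  Hence \<open>G = E[z\<^sup>L]\<close> satisfies \<open>G = P[R\<^sub>1 > \<epsilon>] + E[z\<^bsup>R\<^sub>1\<^esup>; R\<^sub>1 \<le> \<epsilon>] G\<close>. The factor
  \<open>1 - E[z\<^bsup>R\<^sub>1\<^esup>; R\<^sub>1 \<le> \<epsilon>]\<close> is nonzero because \<open>P[R\<^sub>1 > \<epsilon>] > 0\<close>: the walk may start with many
  down-steps.\<close>

section \<open>Trading times of a single path and its restart at the first trading time\<close>

lemma INF_enat_eq_Least:
  "(INF n\<in>{n. P n}. enat n) = (if \<exists>n. P n then enat (LEAST n. P n) else \<infinity>)"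
proof (cases "\<exists>n. P n")
  case True
  have "(INF n\<in>{n. P n}. enat n) = enat (LEAST n. P n)"
  proof (rule antisym)
    show "(INF n\<in>{n. P n}. enat n) \<le> enat (LEAST n. P n)"
      using LeastI_ex[OF True] by (intro INF_lower CollectI)
    show "enat (LEAST n. P n) \<le> (INF n\<in>{n. P n}. enat n)"
      by (rule INF_greatest) (simp add: Least_le)
  qed
  with True show ?thesis by simp
qed (simp add: top_enat_def)

text \<open>A new maximum after time \<open>r\<close> is a new maximum of the path restarted at
  \<open>(r, s r)\<close>, so the induction compares one search for the next record with its
  translate. If a record never comes, both sides are infinite.\<close>

lemma trading_time_shift:
  assumes "trading_time s 1 = enat r"
  shows "trading_time s (Suc i) = enat r + trading_time (\<lambda>n. s (r + n) - s r) i"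
proof (induction i)
  case 0
  show ?case using assms by (simp add: zero_enat_def)
next
  case (Suc i)
  let ?s = "\<lambda>n. s (r + n) - s r"
  show ?case
  proof (cases "trading_time ?s i")
    case (enat m)
    let ?P = "\<lambda>n. r + m < n \<and> s (r + m) < s n"
    have shift: "?P n \<longleftrightarrow> r \<le> n \<and> m < n - r \<and> ?s m < ?s (n - r)" for n
      by auto
    have "(INF n\<in>{n. ?P n}. enat n) = enat r + (INF n\<in>{n. m < n \<and> ?s m < ?s n}. enat n)"
    proof (rule antisym)
      \<comment> \<open>Subtracting the finite \<open>enat r\<close> leaves a bare infimum on the
        right, to which \<open>INF_greatest\<close> applies.\<close>
      have "(INF n\<in>{n. ?P n}. enat n) - enat r \<le> (INF n\<in>{n. m < n \<and> ?s m < ?s n}. enat n)"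
      proof (rule INF_greatest)
        fix n assume "n \<in> {n. m < n \<and> ?s m < ?s n}"
        then have "(INF n\<in>{n. ?P n}. enat n) \<le> enat (r + n)"
          by (intro INF_lower) auto
        then show "(INF n\<in>{n. ?P n}. enat n) - enat r \<le> enat n"
          by (cases "INF n\<in>{n. ?P n}. enat n") auto
      qed
      then show "(INF n\<in>{n. ?P n}. enat n)
          \<le> enat r + (INF n\<in>{n. m < n \<and> ?s m < ?s n}. enat n)"
        by (cases "INF n\<in>{n. ?P n}. enat n"; cases "INF n\<in>{n. m < n \<and> ?s m < ?s n}. enat n") auto
      show "enat r + (INF n\<in>{n. m < n \<and> ?s m < ?s n}. enat n) \<le> (INF n\<in>{n. ?P n}. enat n)"
      proof (rule INF_greatest)
        fix n assume "n \<in> {n. ?P n}"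
        then have n: "r \<le> n" and "n - r \<in> {n. m < n \<and> ?s m < ?s n}"
          using shift by auto
        then have "(INF n\<in>{n. m < n \<and> ?s m < ?s n}. enat n) \<le> enat (n - r)"
          by (intro INF_lower)
        then have "enat r + (INF n\<in>{n. m < n \<and> ?s m < ?s n}. enat n) \<le> enat r + enat (n - r)"
          by (rule add_left_mono)
        with n show "enat r + (INF n\<in>{n. m < n \<and> ?s m < ?s n}. enat n) \<le> enat n"
          by simp
      qed
    qed
    then show ?thesis using Suc enat by simp
  qed (use Suc in simp)
qed

lemma intertrading_time_1: "intertrading_time s 1 = trading_time s 1"
  by (simp add: intertrading_time_def)

text \<open>The common offset \<open>enat r\<close> cancels in differences of trading times; as it
  is finite, this remains true when a trading time is infinite.\<close>

lemma intertrading_time_shift: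
  assumes "intertrading_time s 1 = enat r"
  shows "intertrading_time s (Suc (Suc i)) = intertrading_time (\<lambda>n. s (r + n) - s r) (Suc i)"
proof -
  have r: "trading_time s 1 = enat r" using assms unfolding intertrading_time_1 .
  have *: "enat r + a - (enat r + b) = a - b" for a b
    by (cases a; cases b) auto
  show ?thesis
    unfolding intertrading_time_def diff_Suc_1 trading_time_shift[OF r] * ..
qed

lemma avalanche_length_eq_0:
  assumes "ereal_of_enat (intertrading_time s 1) > ereal \<epsilon>"
  shows "avalanche_length \<epsilon> s = 0"
proof -
  have "enat (avalanche_length \<epsilon> s) = (\<Sum>i=1..0. intertrading_time s i)"
    by (rule avalanche_length_eq) (use assms in \<open>unfold add_0, auto\<close>)
  then show ?thesis by (simp add: zero_enat_def)
qed

text \<open>The restarted avalanche lacks exactly the first summand, so its \<open>LEAST\<close>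
  index is smaller by one. The assumption \<open>stops\<close> ensures that the minimum is attained,
  so that no unspecified value enters.\<close>

lemma avalanche_length_shift:
  assumes r: "intertrading_time s 1 = enat r" and "real r \<le> \<epsilon>"
    and stops: "ereal_of_enat (intertrading_time (\<lambda>n. s (r + n) - s r) (Suc j)) > ereal \<epsilon>"
  shows "avalanche_length \<epsilon> s = r + avalanche_length \<epsilon> (\<lambda>n. s (r + n) - s r)"
proof -
  let ?s = "\<lambda>n. s (r + n) - s r"
  define k where "k = (LEAST k. ereal_of_enat (intertrading_time ?s (k + 1)) > ereal \<epsilon>)"
  have "(LEAST k. ereal_of_enat (intertrading_time s (k + 1)) > ereal \<epsilon>)
      = Suc (LEAST k. ereal_of_enat (intertrading_time s (Suc k + 1)) > ereal \<epsilon>)"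
  proof (rule Least_Suc)
    show "ereal_of_enat (intertrading_time s (Suc j + 1)) > ereal \<epsilon>"
      using stops by (simp add: intertrading_time_shift[OF r])
    show "\<not> ereal_of_enat (intertrading_time s (0 + 1)) > ereal \<epsilon>"
      unfolding add_0 r using assms(2) by simp
  qed
  then have "(LEAST k. ereal_of_enat (intertrading_time s (k + 1)) > ereal \<epsilon>) = Suc k"
    by (simp add: k_def intertrading_time_shift[OF r])
  then have "avalanche_length \<epsilon> s = (\<Sum>i=1..Suc k. the_enat (intertrading_time s i))"
    by (simp add: avalanche_length_def)
  also have "\<dots> = r + (\<Sum>i=Suc 1..Suc k. the_enat (intertrading_time s i))"
    using r by (simp add: sum.atLeast_Suc_atMost)
  also have "(\<Sum>i=Suc 1..Suc k. the_enat (intertrading_time s i))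
      = (\<Sum>i=1..k. the_enat (intertrading_time s (Suc i)))"
    by (rule sum.shift_bounds_cl_Suc_ivl)
  also have "\<dots> = avalanche_length \<epsilon> ?s"
    unfolding avalanche_length_def Let_def k_def[symmetric]
  proof (rule sum.cong)
    fix i assume "i \<in> {1..k}"
    then show "the_enat (intertrading_time s (Suc i)) = the_enat (intertrading_time ?s i)"
      using intertrading_time_shift[OF r, of "i - 1"] by simp
  qed simp
  finally show ?thesis .
qed

text \<open>The right-hand side inspects the path only up to time \<open>r\<close>; this is the
  stopping-time property behind the renewal argument.\<close>

lemma intertrading_time_1_eq_iff:
  "intertrading_time s 1 = enat r \<longleftrightarrow> 0 < r \<and> s 0 < s r \<and> (\<forall>n. 0 < n \<and> n < r \<longrightarrow> s n \<le> s 0)"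
proof -
  let ?P = "\<lambda>n. 0 < n \<and> s 0 < s n"
  have "intertrading_time s 1 = (INF n\<in>{n. ?P n}. enat n)"
    unfolding intertrading_time_1 by (simp add: zero_enat_def)
  also have "\<dots> = enat r \<longleftrightarrow> (\<exists>n. ?P n) \<and> (LEAST n. ?P n) = r"
    by (simp add: INF_enat_eq_Least)
  also have "\<dots> \<longleftrightarrow> ?P r \<and> (\<forall>n. ?P n \<longrightarrow> r \<le> n)"
    using LeastI_ex[of ?P] Least_le[of ?P] Least_equality[of ?P r] by blast
  finally show ?thesis
    by (auto simp: not_less not_le)
qed

section \<open>Measurability of the path functionals\<close>

lemma measurable_trading_time [measurable (raw)]:
  assumes [measurable]: "\<And>n. S n \<in> N \<rightarrow>\<^sub>M count_space UNIV"
  shows "(\<lambda>\<omega>. trading_time (\<lambda>n. S n \<omega>) i) \<in> N \<rightarrow>\<^sub>M count_space UNIV"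
proof (induction i)
  case (Suc i)
  note Suc [measurable]
  show ?case
    \<comment> \<open>With \<open>LEAST\<close> in place of the infimum, only countably many
      measurable conditions are involved.\<close>
    unfolding trading_time.simps INF_enat_eq_Least by measurable
qed simp

lemma measurable_intertrading_time [measurable (raw)]:
  assumes [measurable]: "\<And>n. S n \<in> N \<rightarrow>\<^sub>M count_space UNIV"
  shows "(\<lambda>\<omega>. intertrading_time (\<lambda>n. S n \<omega>) i) \<in> N \<rightarrow>\<^sub>M count_space UNIV"
  unfolding intertrading_time_def by measurable

lemma measurable_avalanche_length [measurable (raw)]:
  assumes [measurable]: "\<And>n. S n \<in> N \<rightarrow>\<^sub>M count_space UNIV"
  shows "(\<lambda>\<omega>. avalanche_length \<epsilon> (\<lambda>n. S n \<omega>)) \<in> N \<rightarrow>\<^sub>M count_space UNIV"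
proof -
  have [measurable]: "(\<lambda>\<omega>. \<Sum>i=1..k. the_enat (intertrading_time (\<lambda>n. S n \<omega>) i))
      \<in> N \<rightarrow>\<^sub>M count_space UNIV" for k
    by (induction k) simp_all
  show ?thesis
    unfolding avalanche_length_def Let_def
    \<comment> \<open>The random number of summands is countably valued, so it suffices to treat
      each fixed number \<open>k\<close>.\<close>
    by (rule measurable_compose_countable[where f = "\<lambda>k \<omega>. \<Sum>i=1..k. the_enat (intertrading_time (\<lambda>n. S n \<omega>) i)"]) measurable
qed

section \<open>Paths as partial sums of step sequences\<close>

definition walk :: "(nat \<Rightarrow> int) \<Rightarrow> nat \<Rightarrow> int" where
  "walk x n = (\<Sum>i<n. x i)"

lemma walk_0 [simp]: "walk x 0 = 0"
  by (simp add: walk_def)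

lemma walk_Suc: "walk x (Suc n) = walk x n + x n"
  by (simp add: walk_def)

lemma walk_shift: "walk (\<lambda>n. x (r + n)) n = walk x (r + n) - walk x r"
  by (induction n) (simp_all add: walk_def)

lemma walk_comb_seq: "n \<le> r \<Longrightarrow> walk (comb_seq r x y) n = walk x n"
  unfolding walk_def by (intro sum.cong) (auto simp: comb_seq_less)

lemma walk_increments: "walk (\<lambda>n. s (Suc n) - s n) n = s n - s 0"
  by (induction n) (simp_all add: walk_def)

text \<open>Here the stopping condition concerns the original walk. Its index \<open>j\<close>
  cannot be 0, since the first intertrading time is at most \<open>\<epsilon>\<close>, so it carries
  over to the restarted walk.\<close>

lemma avalanche_length_walk_shift:
  assumes "intertrading_time (walk x) 1 = enat r" "real r \<le> \<epsilon>"
    and "ereal_of_enat (intertrading_time (walk x) (Suc j)) > ereal \<epsilon>"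
  shows "avalanche_length \<epsilon> (walk x) = r + avalanche_length \<epsilon> (walk (\<lambda>n. x (r + n)))"
proof -
  obtain i where j: "j = Suc i"
    using assms by (cases j) auto
  show ?thesis
    using avalanche_length_shift[OF assms(1,2), of i] assms(3)
    by (simp add: j walk_shift[abs_def] intertrading_time_shift[OF assms(1)])
qed

definition first_trade :: "nat \<Rightarrow> (nat \<Rightarrow> int) set" where
  "first_trade r = {x. intertrading_time (walk x) 1 = enat r}"

text \<open>The event is decided by partial sums up to time \<open>r\<close>, so the steps spliced
  in from index \<open>r\<close> on do not affect it.\<close>

lemma first_trade_comb_seq [simp]: "comb_seq r x y \<in> first_trade r \<longleftrightarrow> x \<in> first_trade r"
  unfolding first_trade_def mem_Collect_eq intertrading_time_1_eq_iff by (auto simp: walk_comb_seq)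

lemma finite_nat_le_real [simp]: "finite {r::nat. real r \<le> \<epsilon>}"
  by (rule finite_subset[of _ "{..nat \<lfloor>\<epsilon>\<rfloor>}"]) (auto simp: le_nat_floor)

text \<open>The events \<open>first_trade r\<close> are disjoint and, for \<open>r\<close> up to
  \<open>\<epsilon>\<close>, make up the event of a short first intertrading time. The sum is
  finite, so expectations split over it without a convergence question.\<close>

lemma sum_first_trade:
  fixes h :: "nat \<Rightarrow> 'b::real_vector"
  shows "(\<Sum>r | real r \<le> \<epsilon>. indicator (first_trade r) x *\<^sub>R h r)
    = indicator {x. ereal_of_enat (intertrading_time (walk x) 1) \<le> ereal \<epsilon>} x
        *\<^sub>R h (the_enat (intertrading_time (walk x) 1))"
proof (cases "intertrading_time (walk x) 1")
  case (enat r0)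
  have "(\<Sum>r | real r \<le> \<epsilon>. indicator (first_trade r) x *\<^sub>R h r)
      = (\<Sum>r | real r \<le> \<epsilon>. if r = r0 then h r else 0)"
    unfolding first_trade_def indicator_def mem_Collect_eq enat by (intro sum.cong) auto
  then show ?thesis
    unfolding first_trade_def indicator_def mem_Collect_eq enat by simp
next
  case infinity
  then show ?thesis
    unfolding first_trade_def indicator_def mem_Collect_eq infinity by simp
qed

section \<open>Independent steps on the canonical sequence space and the renewal identity\<close>

locale iid_steps = sequence_space "measure_pmf \<mu>" for \<mu> :: "int pmf"
begin

lemma space_steps [simp]: "space S = UNIV"
  by (simp add: space_PiM)

lemma measurable_walk [measurable]: "(\<lambda>x. walk x n) \<in> S \<rightarrow>\<^sub>M count_space UNIV"
proof -
  have [measurable]: "(\<lambda>x. x i) \<in> S \<rightarrow>\<^sub>M count_space UNIV" for i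
    using measurable_component_singleton[of i UNIV "\<lambda>_. measure_pmf \<mu>"] by simp
  show ?thesis
  proof (induction n)
    case (Suc n)
    note Suc [measurable]
    show ?case
      unfolding walk_Suc by measurable
  qed simp
qed

lemma measurable_intertrading_time_walk [measurable]:
  "(\<lambda>x. intertrading_time (walk x) i) \<in> S \<rightarrow>\<^sub>M count_space UNIV"
  using measurable_intertrading_time[of "\<lambda>n x. walk x n", OF measurable_walk] by simp

lemma measurable_avalanche_length_walk [measurable]:
  "(\<lambda>x. avalanche_length \<epsilon> (walk x)) \<in> S \<rightarrow>\<^sub>M count_space UNIV"
  using measurable_avalanche_length[of "\<lambda>n x. walk x n", OF measurable_walk] by simp

lemma measurable_shift [measurable]: "(\<lambda>x n. x (r + n)) \<in> S \<rightarrow>\<^sub>M S"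
  by (rule measurable_PiM_single') auto

lemma sets_first_trade [measurable]: "first_trade r \<in> sets S"
proof -
  have "{x \<in> space S. intertrading_time (walk x) 1 = enat r} \<in> sets S"
    by measurable
  then show ?thesis by (simp add: first_trade_def)
qed

text \<open>Gluing the first \<open>r\<close> steps of \<open>x\<close> to an independent sequence
  \<open>y\<close> preserves the product measure. The event then depends on \<open>x\<close> alone
  and the shifted sequence is \<open>y\<close>, so Fubini factorizes the integral.\<close>

lemma renewal:
  fixes f :: "(nat \<Rightarrow> int) \<Rightarrow> 'b::{banach, second_countable_topology}"
  assumes [measurable]: "f \<in> borel_measurable S" and bound: "\<And>x. norm (f x) \<le> B"
  shows "(LINT x|S. indicator (first_trade r) x *\<^sub>R f (\<lambda>n. x (r + n)))
    = prob (first_trade r) *\<^sub>R (LINT x|S. f x)"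
proof -
  interpret SS: pair_prob_space S S ..
  have "(LINT x|S. indicator (first_trade r) x *\<^sub>R f (\<lambda>n. x (r + n)))
      = (LINT x|distr (S \<Otimes>\<^sub>M S) S (\<lambda>(x, y). comb_seq r x y).
          indicator (first_trade r) x *\<^sub>R f (\<lambda>n. x (r + n)))"
    by (simp only: PiM_comb_seq)
  also have "\<dots> = (LINT w|(S \<Otimes>\<^sub>M S). indicator (first_trade r) (fst w) *\<^sub>R f (snd w))"
    by (subst integral_distr)
      (auto simp: split_beta' indicator_def comb_seq_def intro!: Bochner_Integration.integral_cong)
  also have "\<dots> = (LINT x|S. LINT y|S. indicator (first_trade r) x *\<^sub>R f y)"
  proof (subst SS.integral_fst'[symmetric])
    show "integrable (S \<Otimes>\<^sub>M S) (\<lambda>w. indicator (first_trade r) (fst w) *\<^sub>R f (snd w))"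
      \<comment> \<open>As a bound on a norm, \<open>B\<close> is nonnegative, which covers the
        points where the indicator vanishes.\<close>
      using bound order_trans[OF norm_ge_zero bound]
      by (intro SS.P.integrable_const_bound[where B = B]) (auto simp: indicator_def)
  qed simp
  also have "\<dots> = (LINT x|S. indicator (first_trade r) x *\<^sub>R (LINT y|S. f y))"
    by simp
  also have "\<dots> = prob (first_trade r) *\<^sub>R (LINT x|S. f x)"
    by (subst integral_scaleR_left) (auto simp: emeasure_eq_measure)
  finally show ?thesis .
qed

lemma integral_sum_first_trade:
  fixes f :: "nat \<Rightarrow> (nat \<Rightarrow> int) \<Rightarrow> 'b::{banach, second_countable_topology}"
  assumes [measurable]: "\<And>r. f r \<in> borel_measurable S" and bound: "\<And>r x. norm (f r x) \<le> B"
  shows "(LINT x|S. (\<Sum>r | real r \<le> \<epsilon>. indicator (first_trade r) x *\<^sub>R f r (\<lambda>n. x (r + n))))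
    = (\<Sum>r | real r \<le> \<epsilon>. prob (first_trade r) *\<^sub>R (LINT x|S. f r x))"
proof -
  have "integrable S (\<lambda>x. indicator (first_trade r) x *\<^sub>R f r (\<lambda>n. x (r + n)))" for r
    using bound order_trans[OF norm_ge_zero bound]
    by (intro integrable_const_bound[where B = B]) (auto simp: indicator_def)
  then have "(LINT x|S. (\<Sum>r | real r \<le> \<epsilon>. indicator (first_trade r) x *\<^sub>R f r (\<lambda>n. x (r + n))))
      = (\<Sum>r | real r \<le> \<epsilon>. LINT x|S. indicator (first_trade r) x *\<^sub>R f r (\<lambda>n. x (r + n)))"
    by (rule Bochner_Integration.integral_sum)
  also have "\<dots> = (\<Sum>r | real r \<le> \<epsilon>. prob (first_trade r) *\<^sub>R (LINT x|S. f r x))"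
    by (intro sum.cong refl renewal[where B = B] bound) measurable
  finally show ?thesis .
qed

section \<open>Tail of the first intertrading time and almost sure end of the avalanche\<close>

lemma sets_first_trade_le_gt [measurable]:
  "{x. ereal_of_enat (intertrading_time (walk x) 1) \<le> ereal \<epsilon>} \<in> sets S"
  "{x. ereal_of_enat (intertrading_time (walk x) 1) > ereal \<epsilon>} \<in> sets S"
proof -
  have "{x \<in> space S. ereal_of_enat (intertrading_time (walk x) 1) \<le> ereal \<epsilon>} \<in> sets S"
    "{x \<in> space S. ereal_of_enat (intertrading_time (walk x) 1) > ereal \<epsilon>} \<in> sets S"
    by measurable
  then show "{x. ereal_of_enat (intertrading_time (walk x) 1) \<le> ereal \<epsilon>} \<in> sets S"
    "{x. ereal_of_enat (intertrading_time (walk x) 1) > ereal \<epsilon>} \<in> sets S"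
    by simp_all
qed

lemma sum_prob_first_trade:
  "(\<Sum>r | real r \<le> \<epsilon>. prob (first_trade r))
    = 1 - prob {x. ereal_of_enat (intertrading_time (walk x) 1) > ereal \<epsilon>}"
proof -
  have "(\<Sum>r | real r \<le> \<epsilon>. prob (first_trade r))
      = (LINT x|S. (\<Sum>r | real r \<le> \<epsilon>. indicator (first_trade r) x *\<^sub>R (1::real)))"
    by (subst integral_sum_first_trade[where f = "\<lambda>_ _. 1" and B = 1]) (auto simp: P.prob_space[simplified])
  also have "\<dots> = prob {x. ereal_of_enat (intertrading_time (walk x) 1) \<le> ereal \<epsilon>}"
    unfolding sum_first_trade by simp
  also have "{x. ereal_of_enat (intertrading_time (walk x) 1) \<le> ereal \<epsilon>}
      = space S - {x. ereal_of_enat (intertrading_time (walk x) 1) > ereal \<epsilon>}"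
    by auto
  also have "prob \<dots> = 1 - prob {x. ereal_of_enat (intertrading_time (walk x) 1) > ereal \<epsilon>}"
    by (rule prob_compl) measurable
  finally show ?thesis .
qed


text \<open>If the first \<open>K\<close> steps all go down, the walk is not above 0 up to time
  \<open>K\<close>. By independence this has positive probability.\<close>

lemma prob_first_trade_gt_pos:
  assumes "pmf \<mu> (-1) > 0"
  shows "prob {x. ereal_of_enat (intertrading_time (walk x) 1) > ereal \<epsilon>} > 0"
proof -
  define K where "K = nat \<lceil>\<epsilon>\<rceil>"
  have "0 < (\<Prod>i<K. pmf \<mu> (-1))"
    using assms by (intro prod_pos) auto
  also have "\<dots> = prob {x. \<forall>i<K. x i = -1}"
  proof -
    have "ennreal (prob {x. \<forall>i<K. x i = -1}) = (\<Prod>i<K. ennreal (pmf \<mu> (-1)))"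
      using emeasure_PiM_Collect[of "{..<K}" "\<lambda>_. {-1}"]
      by (simp add: emeasure_eq_measure emeasure_pmf_single Ball_def)
    also have "\<dots> = ennreal (\<Prod>i<K. pmf \<mu> (-1))"
      by (rule prod_ennreal) simp
    finally show ?thesis
      by (simp add: prod_nonneg)
  qed
  also have "\<dots> \<le> prob {x. ereal_of_enat (intertrading_time (walk x) 1) > ereal \<epsilon>}"
  proof (rule finite_measure_mono)
    show "{x. \<forall>i<K. x i = -1} \<subseteq> {x. ereal_of_enat (intertrading_time (walk x) 1) > ereal \<epsilon>}"
    proof safe
      fix x :: "nat \<Rightarrow> int" assume x: "\<forall>i<K. x i = -1"
      show "ereal_of_enat (intertrading_time (walk x) 1) > ereal \<epsilon>"
      proof (cases "intertrading_time (walk x) 1")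
        case (enat r)
        then have "walk x r > 0"
          unfolding intertrading_time_1_eq_iff by simp
        moreover have "walk x r = - int r" if "r \<le> K"
          using x that by (simp add: walk_def)
        ultimately have "r > K"
          by fastforce
        then have "\<epsilon> < real r"
          unfolding K_def by linarith
        then show ?thesis
          unfolding enat by simp
      qed (simp only: ereal_of_enat_simps, simp)
    qed
  qed measurable
  finally show ?thesis .
qed

text \<open>The avalanche never ends iff \<open>R\<^sub>1 \<le> \<epsilon>\<close> and the avalanche of the restarted walk never ends, so the
  probability \<open>q\<close> of this event satisfies \<open>q = P[R\<^sub>1 \<le> \<epsilon>] q\<close>.\<close>

lemma AE_avalanche_ends:
  assumes "pmf \<mu> (-1) > 0"
  shows "AE x in S. \<exists>j. ereal_of_enat (intertrading_time (walk x) (Suc j)) > ereal \<epsilon>"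
proof -
  let ?E = "{r. real r \<le> \<epsilon>}"
  define N where "N = {x. \<forall>j. ereal_of_enat (intertrading_time (walk x) (Suc j)) \<le> ereal \<epsilon>}"
  have "{x \<in> space S. \<forall>j. ereal_of_enat (intertrading_time (walk x) (Suc j)) \<le> ereal \<epsilon>} \<in> sets S"
    by measurable
  then have N [measurable]: "N \<in> sets S"
    by (simp add: N_def)
  have step: "indicat_real N x = (\<Sum>r\<in>?E. indicator (first_trade r) x *\<^sub>R indicat_real N (\<lambda>n. x (r + n)))" for x
  proof (cases "ereal_of_enat (intertrading_time (walk x) 1) \<le> ereal \<epsilon>")
    case True
    then obtain r where r: "intertrading_time (walk x) 1 = enat r"
      by (cases "intertrading_time (walk x) 1") auto
    \<comment> \<open>The condition for \<open>j = 0\<close> holds by the case assumption; the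
      remaining ones are those of the restarted walk.\<close>
    have "x \<in> N \<longleftrightarrow> (\<lambda>n. x (r + n)) \<in> N"
      unfolding N_def mem_Collect_eq walk_shift[abs_def] intertrading_time_shift[OF r, symmetric]
      using True by (metis One_nat_def not0_implies_Suc)
    then show ?thesis
      using True unfolding sum_first_trade unfolding indicator_def mem_Collect_eq r by simp
  next
    case False
    then have "x \<notin> N"
      unfolding N_def mem_Collect_eq by (metis One_nat_def)
    with False show ?thesis
      unfolding sum_first_trade by simp
  qed
  have "prob N = (LINT x|S. indicat_real N x)"
    by simp
  also have "\<dots> = (LINT x|S. (\<Sum>r\<in>?E. indicator (first_trade r) x *\<^sub>R indicat_real N (\<lambda>n. x (r + n))))"
    unfolding step[symmetric] ..
  also have "\<dots> = (\<Sum>r\<in>?E. prob (first_trade r)) * prob N"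
    by (subst integral_sum_first_trade[where f = "\<lambda>_. indicat_real N" and B = 1])
      (auto simp: sum_distrib_right)
  \<comment> \<open>With \<open>p\<close> the probability of a long first intertrading time, the
    equation reads \<open>prob N = (1 - p) * prob N\<close>, and \<open>p\<close> is
    positive.\<close>
  finally have "prob N = 0"
    using prob_first_trade_gt_pos[OF assms, of \<epsilon>]
    by (auto simp: sum_prob_first_trade algebra_simps)
  then have "N \<in> null_sets S"
    using N by (simp add: null_sets_def emeasure_eq_measure)
  then show ?thesis
    by (rule AE_I') (auto simp: N_def not_less)
qed

section \<open>The renewal equation for the generating function and its solution\<close>

lemma integral_power_avalanche_length:
  fixes z :: complex and \<epsilon> :: real
  defines "p \<equiv> prob {x. ereal_of_enat (intertrading_time (walk x) 1) > ereal \<epsilon>}"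
  assumes pmf: "pmf \<mu> (-1) > 0" and z: "norm z \<le> 1"
  shows "(LINT x|S. z ^ avalanche_length \<epsilon> (walk x)) = complex_of_real p /
    ((LINT x:{x. ereal_of_enat (intertrading_time (walk x) 1) \<le> ereal \<epsilon>}|S.
        1 - z ^ the_enat (intertrading_time (walk x) 1)) + complex_of_real p)"
proof -
  let ?E = "{r. real r \<le> \<epsilon>}"
  let ?L = "\<lambda>x. avalanche_length \<epsilon> (walk x)"
  let ?gt = "{x. ereal_of_enat (intertrading_time (walk x) 1) > ereal \<epsilon>}"
  define G where "G = (LINT x|S. z ^ ?L x)"
  define c where "c = (\<Sum>r\<in>?E. complex_of_real (prob (first_trade r)) * z ^ r)"
  have z_pow: "norm (z ^ n) \<le> 1" for n
    using z by (simp add: norm_power power_le_one)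
  \<comment> \<open>The identity is claimed only almost everywhere, since the length is unspecified
    on paths whose avalanche never ends.\<close>
  have AE_eq: "AE x in S. z ^ ?L x = complex_of_real (indicator ?gt x)
      + (\<Sum>r\<in>?E. indicator (first_trade r) x *\<^sub>R (z ^ r * z ^ ?L (\<lambda>n. x (r + n))))"
    using AE_avalanche_ends[OF pmf, of \<epsilon>]
  proof eventually_elim
    case (elim x)
    then obtain j where j: "ereal_of_enat (intertrading_time (walk x) (Suc j)) > ereal \<epsilon>" ..
    show ?case
    proof (cases "ereal_of_enat (intertrading_time (walk x) 1) \<le> ereal \<epsilon>")
      case True
      then obtain r where r: "intertrading_time (walk x) 1 = enat r"
        by (cases "intertrading_time (walk x) 1") auto
      with True have "real r \<le> \<epsilon>"
        by simp
      from avalanche_length_walk_shift[OF r this j]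
      have "z ^ ?L x = z ^ r * z ^ ?L (\<lambda>n. x (r + n))"
        by (simp add: power_add)
      then show ?thesis
        using True unfolding sum_first_trade unfolding indicator_def mem_Collect_eq r by simp
    next
      case False
      then show ?thesis
        unfolding sum_first_trade unfolding indicator_def mem_Collect_eq
        by (simp add: avalanche_length_eq_0)
    qed
  qed
  have int: "integrable S (\<lambda>x. complex_of_real (indicator ?gt x))"
    by (intro integrable_of_real integrable_real_indicator sets_first_trade_le_gt) (simp add: emeasure_eq_measure)
  have int': "integrable S (\<lambda>x. indicator (first_trade r) x *\<^sub>R (z ^ r * z ^ ?L (\<lambda>n. x (r + n))))" for r
    using z_pow by (intro integrable_const_bound[where B = 1]) (auto simp: indicator_def simp flip: power_add)
  have "G = (LINT x|S. complex_of_real (indicator ?gt x)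
      + (\<Sum>r\<in>?E. indicator (first_trade r) x *\<^sub>R (z ^ r * z ^ ?L (\<lambda>n. x (r + n)))))"
    unfolding G_def by (intro integral_cong_AE AE_eq) measurable
  also have "\<dots> = (LINT x|S. complex_of_real (indicator ?gt x))
      + (LINT x|S. (\<Sum>r\<in>?E. indicator (first_trade r) x *\<^sub>R (z ^ r * z ^ ?L (\<lambda>n. x (r + n)))))"
    by (intro Bochner_Integration.integral_add Bochner_Integration.integrable_sum int int')
  also have "(LINT x|S. complex_of_real (indicator ?gt x)) = complex_of_real p"
    unfolding p_def by simp
  also have "(LINT x|S. (\<Sum>r\<in>?E. indicator (first_trade r) x *\<^sub>R (z ^ r * z ^ ?L (\<lambda>n. x (r + n))))) = c * G"
    using z_pow[unfolded norm_power, of "_ + _", unfolded power_add]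
    by (subst integral_sum_first_trade[where f = "\<lambda>r x. z ^ r * z ^ ?L x" and B = 1])
      (auto simp: c_def G_def sum_distrib_right scaleR_conv_of_real mult.assoc norm_mult norm_power)
  finally have G: "G * (1 - c) = complex_of_real p"
    by (simp add: algebra_simps)
  have "p \<noteq> 0"
    using prob_first_trade_gt_pos[OF pmf, of \<epsilon>] by (simp add: p_def)
  \<comment> \<open>No estimate of \<open>c\<close> is required: a vanishing factor would force
    \<open>p = 0\<close>.\<close>
  with G have "1 - c \<noteq> 0"
    by auto
  have "(LINT x:{x. ereal_of_enat (intertrading_time (walk x) 1) \<le> ereal \<epsilon>}|S.
        1 - z ^ the_enat (intertrading_time (walk x) 1))
      = (LINT x|S. (\<Sum>r\<in>?E. indicator (first_trade r) x *\<^sub>R (1 - z ^ r)))"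
    unfolding sum_first_trade set_lebesgue_integral_def ..
  also have "\<dots> = (\<Sum>r\<in>?E. prob (first_trade r) *\<^sub>R (1 - z ^ r))"
    using z_pow
    \<comment> \<open>The bound 2 comes from the triangle inequality, both terms having norm at most
      1.\<close>
    by (subst integral_sum_first_trade[where f = "\<lambda>r _. 1 - z ^ r" and B = 2])
      (auto simp: P.prob_space[simplified] intro!: norm_triangle_le_diff order_trans[OF norm_triangle_ineq4] add_mono)
  also have "\<dots> = complex_of_real (\<Sum>r\<in>?E. prob (first_trade r)) - c"
    by (simp add: c_def scaleR_conv_of_real right_diff_distrib sum_subtractf)
  also have "\<dots> = 1 - complex_of_real p - c"
    unfolding sum_prob_first_trade p_def by simp
  finally have denominator: "(LINT x:{x. ereal_of_enat (intertrading_time (walk x) 1) \<le> ereal \<epsilon>}|S.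
        1 - z ^ the_enat (intertrading_time (walk x) 1)) + complex_of_real p = 1 - c"
    by simp
  show ?thesis
    unfolding denominator G_def[symmetric] using G \<open>1 - c \<noteq> 0\<close> by (simp add: nonzero_eq_divide_eq)
qed

end

section \<open>Transfer from the canonical step space to the given walk\<close>

lemma (in simple_symmetric_random_walk) distr_increments_PiM:
  "distr M (\<Pi>\<^sub>M n\<in>UNIV. count_space UNIV) (\<lambda>\<omega> n. S (Suc n) \<omega> - S n \<omega>)
    = (\<Pi>\<^sub>M n\<in>UNIV. measure_pmf (pmf_of_set {-1, 1}))"
proof -
  have "random_variable (count_space UNIV) (\<lambda>\<omega>. S (Suc n) \<omega> - S n \<omega>)" for n
    using indep_increments by (auto simp: indep_vars_def)
  then show ?thesis
    \<comment> \<open>Independence says that the joint law of the increments is the product of their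
      marginal laws.\<close>
    using indep_increments
    by (subst (asm) indep_vars_iff_distr_eq_PiM) (simp_all add: distr_increments restrict_def)
qed

theorem proposition1:
  fixes M :: "'a measure" and S :: "nat \<Rightarrow> 'a \<Rightarrow> int" and \<epsilon> :: real and z :: complex
  defines "R\<^sub>1 \<equiv> (\<lambda>\<omega>. intertrading_time (\<lambda>n. S n \<omega>) 1)"
    and "L \<equiv> (\<lambda>\<omega>. avalanche_length \<epsilon> (\<lambda>n. S n \<omega>))"
  defines "p \<equiv> measure M {\<omega> \<in> space M. ereal_of_enat (R\<^sub>1 \<omega>) > ereal \<epsilon>}"
  assumes "simple_symmetric_random_walk M S"
    and "\<epsilon> > 0"
    and "norm z \<le> 1"
  shows "(LINT \<omega>|M. z ^ L \<omega>) =
    complex_of_real p /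
    ((LINT \<omega>:{\<omega> \<in> space M. ereal_of_enat (R\<^sub>1 \<omega>) \<le> ereal \<epsilon>}|M. 1 - z ^ the_enat (R\<^sub>1 \<omega>))
      + complex_of_real p)"
proof -
  interpret RW: simple_symmetric_random_walk M S by fact
  interpret iid_steps "pmf_of_set {-1, 1}" ..
  let ?Q = "\<Pi>\<^sub>M n\<in>(UNIV::nat set). measure_pmf (pmf_of_set {-1, 1::int})"
  define X where "X \<omega> n = S (Suc n) \<omega> - S n \<omega>" for \<omega> n
  have "(\<lambda>\<omega>. X \<omega> n) \<in> M \<rightarrow>\<^sub>M count_space UNIV" for n
    using RW.indep_increments by (auto simp: RW.indep_vars_def X_def)
  then have X [measurable]: "X \<in> M \<rightarrow>\<^sub>M ?Q"
    by (intro measurable_PiM_single') (auto simp: X_def)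
  \<comment> \<open>\<open>measure_pmf\<close> carries the discrete sigma-algebra, so both product
    spaces have the same measurable sets.\<close>
  have "distr M ?Q X = distr M (\<Pi>\<^sub>M n\<in>UNIV. count_space UNIV) X"
    by (intro distr_cong sets_PiM_cong) auto
  then have Q: "?Q = distr M ?Q X"
    using RW.distr_increments_PiM by (simp add: X_def[abs_def])
  have walk_X: "walk (X \<omega>) = (\<lambda>n. S n \<omega>)" if "\<omega> \<in> space M" for \<omega>
    using RW.start[OF that] walk_increments[of "\<lambda>n. S n \<omega>"] by (simp add: X_def[abs_def] fun_eq_iff)
  have transfer: "(LINT x|?Q. f (walk x)) = (LINT \<omega>|M. f (\<lambda>n. S n \<omega>))"
    if "(\<lambda>x. f (walk x)) \<in> borel_measurable ?Q" for f :: "(nat \<Rightarrow> int) \<Rightarrow> complex"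
  proof -
    have "(LINT x|?Q. f (walk x)) = (LINT \<omega>|M. f (walk (X \<omega>)))"
      using integral_distr[OF X that] Q by simp
    also have "\<dots> = (LINT \<omega>|M. f (\<lambda>n. S n \<omega>))"
      by (intro Bochner_Integration.integral_cong) (simp_all add: walk_X)
    finally show ?thesis .
  qed
  have "(LINT \<omega>|M. z ^ L \<omega>) = (LINT x|?Q. z ^ avalanche_length \<epsilon> (walk x))"
    unfolding L_def by (rule transfer[symmetric]) measurable
  moreover have "p = prob {x. ereal_of_enat (intertrading_time (walk x) 1) > ereal \<epsilon>}"
  proof -
    have "prob {x. ereal_of_enat (intertrading_time (walk x) 1) > ereal \<epsilon>}
        = measure (distr M ?Q X) {x. ereal_of_enat (intertrading_time (walk x) 1) > ereal \<epsilon>}"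
      using Q by simp
    also have "\<dots> = p"
      unfolding p_def R\<^sub>1_def
      by (subst measure_distr[OF X sets_first_trade_le_gt(2)]) (auto simp: walk_X intro!: arg_cong[where f = "measure M"])
    finally show ?thesis ..
  qed
  moreover have "(LINT \<omega>:{\<omega> \<in> space M. ereal_of_enat (R\<^sub>1 \<omega>) \<le> ereal \<epsilon>}|M. 1 - z ^ the_enat (R\<^sub>1 \<omega>))
      = (LINT x:{x. ereal_of_enat (intertrading_time (walk x) 1) \<le> ereal \<epsilon>}|?Q.
          1 - z ^ the_enat (intertrading_time (walk x) 1))"
  proof -
    \<comment> \<open>The set integral is written as the integral of one functional of the path, the
      form to which \<open>transfer\<close> applies.\<close>
    let ?f = "\<lambda>s. if ereal_of_enat (intertrading_time s 1) \<le> ereal \<epsilon>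
      then 1 - z ^ the_enat (intertrading_time s 1) else 0"
    have "(LINT x:{x. ereal_of_enat (intertrading_time (walk x) 1) \<le> ereal \<epsilon>}|?Q.
        1 - z ^ the_enat (intertrading_time (walk x) 1)) = (LINT x|?Q. ?f (walk x))"
      unfolding set_lebesgue_integral_def by (intro Bochner_Integration.integral_cong) auto
    also have "\<dots> = (LINT \<omega>|M. ?f (\<lambda>n. S n \<omega>))"
      by (rule transfer) measurable
    also have "\<dots> = (LINT \<omega>:{\<omega> \<in> space M. ereal_of_enat (R\<^sub>1 \<omega>) \<le> ereal \<epsilon>}|M.
        1 - z ^ the_enat (R\<^sub>1 \<omega>))"
      unfolding set_lebesgue_integral_def R\<^sub>1_def
      by (intro Bochner_Integration.integral_cong) auto
    finally show ?thesis ..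
  qed
  moreover have "pmf (pmf_of_set {-1, 1::int}) (-1) > 0"
    by simp
  ultimately show ?thesis
    using integral_power_avalanche_length[of z \<epsilon>] \<open>norm z \<le> 1\<close> by simp
qed

end
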